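(* Let $n=2^a m$ for positive integers $a$ and $m$, with $m$ odd. Then there are at least $(m/e^2)^{n^2}$ latin squares of order $n$ that have no odd plexes.
   Context: A latin square of order $n$ is an $n\times n$ array on $n$ symbols with each symbol occurring exactly once in each row and each column, viewed as a set of entries (row, column, symbol). A $k$-plex is a set of $kn$ entries containing exactly $k$ entries from each row and each column, with each symbol occurring exactly $k$ times. An odd plex is a $k$-plex with $k$ odd. *)

theory Defs
  imports Complex_Main
begin

text \<open>
  A latin square of order \<open>n\<close> is represented by its set of entries (row, column, symbol); rows,
  columns and symbols are all indexed by \<open>{0, ..., n - 1}\<close>, so the symbol set is fixed and two
  squares count as different whenever their arrays differ.
\<close>

type_synonym entry = "nat \<times> nat \<times> nat"

definition latin_square :: "nat \<Rightarrow> entry set \<Rightarrow> bool" where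
  "latin_square n L \<longleftrightarrow>
     L \<subseteq> {..<n} \<times> {..<n} \<times> {..<n} \<and>
     (\<forall>r<n. \<forall>c<n. \<exists>!s. (r, c, s) \<in> L) \<and>
     (\<forall>r<n. \<forall>s<n. \<exists>!c. (r, c, s) \<in> L) \<and>
     (\<forall>c<n. \<forall>s<n. \<exists>!r. (r, c, s) \<in> L)"

definition plex :: "nat \<Rightarrow> nat \<Rightarrow> entry set \<Rightarrow> entry set \<Rightarrow> bool" where
  "plex k n L P \<longleftrightarrow>
     P \<subseteq> L \<and>
     card P = k * n \<and>
     (\<forall>i<n. card {(r, c, s) \<in> P. r = i} = k) \<and>
     (\<forall>j<n. card {(r, c, s) \<in> P. c = j} = k) \<and>
     (\<forall>t<n. card {(r, c, s) \<in> P. s = t} = k)"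

definition odd_plex :: "nat \<Rightarrow> entry set \<Rightarrow> entry set \<Rightarrow> bool" where
  "odd_plex n L P \<longleftrightarrow> (\<exists>k. odd k \<and> plex k n L P)"

lemma finite_latin_squares: "finite {L. latin_square n L}"
  by (rule finite_subset[of _ "Pow ({..<n} \<times> {..<n} \<times> {..<n})"])
     (auto simp: latin_square_def)

end

theory Submission
  imports Defs "HOL-Library.FuncSet" "HOL-Computational_Algebra.Fundamental_Theorem_Algebra"
begin

text \<open>
  Take the Cayley table of the integers modulo \<open>2 ^ a\<close> and replace each cell by an arbitrary latin
  square of order \<open>m\<close>; the Delta-lemma excludes odd plexes, and the number of choices is the
  \<open>4 ^ a\<close>-th power of the number of latin squares of order \<open>m\<close>.  The latter is bounded row by row:
  the admissible next rows of a latin rectangle with \<open>m - k\<close> rows are counted by the permanent of a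
  \<open>k\<close>-regular zero-one matrix, which is at least \<open>(k / e) ^ m\<close>, because permanents of doubly
  stochastic matrices of order \<open>m\<close> are at least \<open>e ^ (- m)\<close>.  This weak form of van der Waerden's
  bound follows from Gurvits' method: the directional derivatives of the product of the row forms do
  not vanish on the open upper half space, so their restrictions to lines in positive directions are
  real-rooted.
\<close>

section \<open>Univariate polynomials through their inverse roots\<close>

text \<open>Splitting off one root at a time, with factors normalised to be 1 at 0 instead of monic:
  the value and the derivative at 0 then read off directly, the latter through the sum of the
  inverse roots.\<close>

lemma complex_poly_inverse_roots:
  fixes p :: "complex poly"
  assumes "poly p 0 \<noteq> 0"
  shows "\<exists>xs. p = smult (poly p 0) (\<Prod>x\<leftarrow>xs. [:1, - x:]) \<and>
           (\<forall>x\<in>set xs. x \<noteq> 0 \<and> poly p (1 / x) = 0)"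
  using assms
proof (induction "degree p" arbitrary: p)
  case 0
  then obtain c where "p = [:c:]"
    by (metis degree_eq_zeroE)
  then show ?case
    by (intro exI[of _ "[]"]) simp
next
  case (Suc d)
  then have "\<not> constant (poly p)"
    by (simp add: constant_degree)
  then obtain r where r: "poly p r = 0"
    using fundamental_theorem_of_algebra by blast
  with Suc.prems have r0: "r \<noteq> 0" by auto
  from r obtain q where q: "p = [:- r, 1:] * q"
    by (auto simp: poly_eq_0_iff_dvd)
  have "q \<noteq> 0" using Suc.prems q by auto
  then have "degree p = Suc (degree q)"
    unfolding q by (subst degree_mult_eq) auto
  then have "d = degree q" using Suc.hyps(2) by simp
  moreover have q0: "poly p 0 = - r * poly q 0" by (simp add: q)
  then have "poly q 0 \<noteq> 0" using Suc.prems by auto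
  ultimately obtain xs where xs: "q = smult (poly q 0) (\<Prod>x\<leftarrow>xs. [:1, - x:])"
      "\<forall>x\<in>set xs. x \<noteq> 0 \<and> poly q (1 / x) = 0"
    using Suc.hyps(1) by blast
  have lin: "[:- r, 1:] = smult (- r) [:1, - (1 / r):]"
    using r0 by simp
  have "p = smult (- r) [:1, - (1 / r):] * smult (poly q 0) (\<Prod>x\<leftarrow>xs. [:1, - x:])"
    using q lin xs(1) by metis
  also have "\<dots> = smult (poly p 0) (\<Prod>x\<leftarrow>1 / r # xs. [:1, - x:])"
    unfolding q0 by (simp only: mult_smult_left mult_smult_right smult_smult list.map prod_list.Cons) (simp add: mult.commute)
  finally have "p = smult (poly p 0) (\<Prod>x\<leftarrow>1 / r # xs. [:1, - x:])" .
  moreover have "\<forall>x\<in>set (1 / r # xs). x \<noteq> 0 \<and> poly p (1 / x) = 0"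
    using r r0 xs(2) by (auto simp: q)
  ultimately show ?case by blast
qed

lemma poly_inverse_roots_0: "poly (\<Prod>x\<leftarrow>xs. [:1, - x:]) (0 :: 'a :: comm_ring_1) = 1"
  by (induction xs) auto

lemma poly_pderiv_inverse_roots_0:
  "poly (pderiv (\<Prod>x\<leftarrow>xs. [:1, - x:])) (0 :: 'a :: idom) = - sum_list xs"
  by (induction xs) (auto simp: pderiv_mult pderiv_add pderiv_smult pderiv_pCons poly_inverse_roots_0)

text \<open>The Gauss--Lucas argument: inverse roots in the open upper half plane have a nonzero sum.\<close>
lemma poly_pderiv_0_nonzero:
  fixes p :: "complex poly"
  assumes stable: "\<And>s. Im s \<ge> 0 \<Longrightarrow> poly p s \<noteq> 0" and deg: "degree p > 0"
  shows "poly (pderiv p) 0 \<noteq> 0"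
proof -
  have p0: "poly p 0 \<noteq> 0" using stable[of 0] by simp
  obtain xs where xs: "p = smult (poly p 0) (\<Prod>x\<leftarrow>xs. [:1, - x:])"
      "\<forall>x\<in>set xs. x \<noteq> 0 \<and> poly p (1 / x) = 0"
    using complex_poly_inverse_roots[OF p0] by blast
  \<comment> \<open>The roots lie in the open lower half plane, and inversion exchanges the two half
    planes.\<close>
  have "Im x > 0" if "x \<in> set xs" for x
  proof -
    have "poly p (1 / x) = 0" "x \<noteq> 0" using xs(2) that by auto
    then have "Im (1 / x) < 0" using stable not_le by blast
    then show ?thesis
      using \<open>x \<noteq> 0\<close> by (auto simp: Im_divide zero_less_divide_iff not_sum_power2_lt_zero)
  qed
  \<comment> \<open>Positive degree forces at least one root; an empty sum would vanish.\<close>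
  moreover have "xs \<noteq> []"
    using deg xs(1) by (metis degree_1 degree_smult_eq list.simps(8) not_less0 prod_list.Nil)
  ultimately have "Im (sum_list xs) > 0"
  proof (induction xs)
    case (Cons a xs)
    then show ?case by (cases "xs = []") (auto intro: add_pos_pos)
  qed simp
  then have "sum_list xs \<noteq> 0" by auto
  moreover have "poly (pderiv p) 0 = - poly p 0 * sum_list xs"
    by (subst xs(1)) (simp add: pderiv_smult poly_pderiv_inverse_roots_0)
  ultimately show ?thesis using p0 by simp
qed

text \<open>With inverse roots \<open>- y\<close>, \<open>y\<close> nonnegative, p(t)/p(0) is the
  product of the factors 1 + t y, hence at most the exponential of t times the sum of the
  \<open>y\<close>; that sum is p'(0)/p(0) = \<open>b / a\<close>.\<close>

lemma poly_le_exp_pderiv_0: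
  fixes p :: "complex poly"
  assumes p0: "poly p 0 = of_real a" "a > 0" and p1: "poly (pderiv p) 0 = of_real b"
    and roots: "\<And>s. poly p s = 0 \<Longrightarrow> s \<in> \<real> \<and> Re s < 0"
    and t: "t \<ge> 0" and pt: "poly p (of_real t) = of_real c"
  shows "c \<le> a * exp (t * (b / a))"
proof -
  have "poly p 0 \<noteq> 0" using p0 by simp
  then obtain xs where xs: "p = smult (poly p 0) (\<Prod>x\<leftarrow>xs. [:1, - x:])"
      "\<forall>x\<in>set xs. x \<noteq> 0 \<and> poly p (1 / x) = 0"
    using complex_poly_inverse_roots by blast
  define ys where "ys = map (\<lambda>x. - Re x) xs"
  have neg: "x = of_real (Re x) \<and> Re x < 0" if "x \<in> set xs" for x
  proof -
    have "x \<noteq> 0" and "1 / x \<in> \<real>" "Re (1 / x) < 0" using roots xs(2) that by auto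
    then obtain y where y: "1 / x = of_real y" "y < 0" by (auto elim: Reals_cases)
    then have "x = of_real (1 / y)" using \<open>x \<noteq> 0\<close> by (auto simp: field_simps)
    then show ?thesis using y by (auto simp: divide_less_0_iff)
  qed
  have xs_ys: "xs = map (\<lambda>y. of_real (- y)) ys"
    using neg by (auto simp: ys_def o_def intro!: nth_equalityI) 
  have nonneg: "y \<ge> 0" if "y \<in> set ys" for y
    using neg that by (fastforce simp: ys_def)
  have prod: "poly (\<Prod>x\<leftarrow>map (\<lambda>y. of_real (- y)) zs. [:1, - x:]) (of_real t) =
      (of_real (\<Prod>y\<leftarrow>zs. 1 + t * y) :: complex)" for zs
    by (induction zs) (auto simp: algebra_simps)
  have sum: "sum_list (map (\<lambda>y. of_real (- y)) zs) = (of_real (- sum_list zs) :: complex)" for zs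
    by (induction zs) auto
  have "poly p (of_real t) = of_real (a * (\<Prod>y\<leftarrow>ys. 1 + t * y))"
    by (subst xs(1)) (simp only: poly_smult xs_ys prod p0 of_real_mult)
  then have c: "c = a * (\<Prod>y\<leftarrow>ys. 1 + t * y)" using pt by (metis of_real_eq_iff)
  have "poly (pderiv p) 0 = of_real a * - of_real (- sum_list ys)"
    by (subst xs(1)) (simp only: pderiv_smult poly_smult poly_pderiv_inverse_roots_0 xs_ys sum p0)
  then have "poly (pderiv p) 0 = of_real (a * sum_list ys)" by simp
  then have b: "b = a * sum_list ys" using p1 by (metis of_real_eq_iff)
  have le: "0 \<le> (\<Prod>y\<leftarrow>zs. 1 + t * y) \<and> (\<Prod>y\<leftarrow>zs. 1 + t * y) \<le> exp (t * sum_list zs)"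
    if "\<forall>y\<in>set zs. y \<ge> 0" for zs
    using that
  proof (induction zs)
    case (Cons z zs)
    moreover have "1 + t * z \<le> exp (t * z)" by (rule exp_ge_add_one_self)
    ultimately show ?case
      using t by (auto simp: distrib_left exp_add intro!: mult_mono mult_nonneg_nonneg add_nonneg_nonneg)
  qed simp
  show ?thesis unfolding c b using le[of ys] nonneg p0 by auto
qed

section \<open>Mixed permanents\<close>

text \<open>Sum over all injective placements of the columns \<open>us\<close> into the rows \<open>S\<close>; each
  unoccupied row \<open>i\<close> contributes a factor \<open>z i\<close>.  For \<open>length us = card S\<close> this is a permanent,
  for \<open>length us < card S\<close> an iterated directional derivative of \<open>z \<mapsto> \<Prod>i\<in>S. z i\<close>.\<close>
fun mixed_perm :: "('i \<Rightarrow> 'a :: comm_semiring_1) list \<Rightarrow> 'i set \<Rightarrow> ('i \<Rightarrow> 'a) \<Rightarrow> 'a" where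
  "mixed_perm [] S z = (\<Prod>i\<in>S. z i)"
| "mixed_perm (u # us) S z = (\<Sum>i\<in>S. u i * mixed_perm us (S - {i}) z)"

text \<open>Needed for two homomorphisms: the embedding of the reals and complex
  conjugation.\<close>

lemma mixed_perm_hom:
  assumes "h 0 = 0" "h 1 = 1" "\<And>x y. h (x + y) = h x + h y" "\<And>x y. h (x * y) = h x * h y"
  shows "mixed_perm (map ((\<circ>) h) us) S (h \<circ> z) = h (mixed_perm us S z)"
proof -
  have prod: "(\<Prod>i\<in>T. h (f i)) = h (\<Prod>i\<in>T. f i)" for T :: "'i set" and f
    using assms by (induction T rule: infinite_finite_induct) auto
  have sum: "(\<Sum>i\<in>T. h (f i)) = h (\<Sum>i\<in>T. f i)" for T :: "'i set" and f
    using assms by (induction T rule: infinite_finite_induct) auto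
  show ?thesis
    by (induction us arbitrary: S) (simp_all add: prod sum flip: assms(4))
qed

lemma mixed_perm_of_real:
  "mixed_perm (map ((\<circ>) of_real) us) S (\<lambda>i. of_real (z i)) =
    (of_real (mixed_perm us S z) :: 'a :: {real_algebra_1, comm_semiring_1})"
  using mixed_perm_hom[where h = "of_real :: real \<Rightarrow> 'a" and us = us and S = S and z = z]
  by (simp add: o_def)

lemma mixed_perm_pos:
  fixes z :: "'i \<Rightarrow> real"
  assumes "finite S" "length us \<le> card S" "\<And>i. i \<in> S \<Longrightarrow> z i > 0"
    "\<And>u i. u \<in> set us \<Longrightarrow> i \<in> S \<Longrightarrow> u i > 0"
  shows "mixed_perm us S z > 0"
  using assms
proof (induction us arbitrary: S)
  case Nil
  then show ?case by (auto intro: prod_pos)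
next
  case (Cons u us)
  have "S \<noteq> {}" using Cons.prems by auto
  moreover have "u i * mixed_perm us (S - {i}) z > 0" if "i \<in> S" for i
    using that Cons.prems by (intro mult_pos_pos Cons.IH) auto
  ultimately show ?case using Cons.prems by (auto intro: sum_pos)
qed

text \<open>Once all columns but one are placed, a single row is left, and its factor is the entry
  of the last column there.\<close>

lemma mixed_perm_snoc_last:
  assumes "finite S" "card S = Suc (length us)"
  shows "mixed_perm (us @ [z]) S y = mixed_perm us S z"
  using assms
proof (induction us arbitrary: S)
  case Nil
  then show ?case by (auto simp: card_Suc_eq)
qed (auto intro!: sum.cong)

section \<open>Restrictions to lines and stability on the upper half space\<close>

text \<open>The same recursion run over the polynomial ring makes the restriction to the line
  \<open>z + s * v\<close> a formal polynomial, with roots, degree and derivative available.\<close>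

definition mixed_perm_line ::
    "('i \<Rightarrow> 'a :: idom) list \<Rightarrow> 'i set \<Rightarrow> ('i \<Rightarrow> 'a) \<Rightarrow> ('i \<Rightarrow> 'a) \<Rightarrow> 'a poly" where
  "mixed_perm_line us S z v = mixed_perm (map (\<lambda>u i. [:u i:]) us) S (\<lambda>i. [:z i, v i:])"

lemma poly_mixed_perm_line:
  "poly (mixed_perm_line us S z v) s = mixed_perm us S (\<lambda>i. z i + s * v i)"
  unfolding mixed_perm_line_def by (induction us arbitrary: S) (auto simp: poly_prod poly_sum)

lemma pderiv_sum: "pderiv (\<Sum>i\<in>A. f i) = (\<Sum>i\<in>A. pderiv (f i))"
  by (induction A rule: infinite_finite_induct) (auto simp: pderiv_add)

text \<open>By the product rule, differentiating along \<open>v\<close> replaces the factor of one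
  unoccupied row by the entry of \<open>v\<close> there, which places \<open>v\<close> as a further
  column.\<close>

lemma poly_pderiv_mixed_perm_line_0:
  fixes z :: "'i \<Rightarrow> 'a :: {idom,semiring_char_0}"
  shows "poly (pderiv (mixed_perm_line us S z v)) 0 = mixed_perm (us @ [v]) S z"
  unfolding mixed_perm_line_def
  by (induction us arbitrary: S)
    (auto simp: pderiv_prod pderiv_sum poly_sum poly_prod pderiv_pCons pderiv_smult mult.commute)

text \<open>Each placement leaves \<open>card S - length us\<close> linear factors, whose leading
  coefficients are the entries of \<open>v\<close>.\<close>

lemma coeff_mixed_perm_line_top:
  assumes "finite S" "length us \<le> card S" "\<And>i. i \<in> S \<Longrightarrow> v i \<noteq> 0"
  shows "coeff (mixed_perm_line us S z v) (card S - length us) = mixed_perm us S v"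
  unfolding mixed_perm_line_def using assms
proof (induction us arbitrary: S)
  case Nil
  have "degree (\<Prod>i\<in>S. [:z i, v i:]) = card S"
    using Nil by (subst degree_prod_eq_sum_degree) auto
  moreover have "lead_coeff (\<Prod>i\<in>S. [:z i, v i:]) = (\<Prod>i\<in>S. v i)"
    unfolding lead_coeff_prod using Nil by (intro prod.cong) auto
  ultimately show ?case by simp
next
  case (Cons u us)
  have "coeff (mixed_perm (map (\<lambda>u i. [:u i:]) us) (S - {i}) (\<lambda>i. [:z i, v i:]))
      (card S - length (u # us)) = mixed_perm us (S - {i}) v" if "i \<in> S" for i
    using Cons.IH[of "S - {i}"] Cons.prems that by simp
  then show ?case by (simp add: coeff_sum)
qed

lemma degree_mixed_perm_line_pos:
  assumes "finite S" "length us < card S" "\<And>i. i \<in> S \<Longrightarrow> v i > 0"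
    "\<And>u i. u \<in> set us \<Longrightarrow> i \<in> S \<Longrightarrow> u i > 0"
  shows "degree (mixed_perm_line (map ((\<circ>) complex_of_real) us) S z (\<lambda>i. of_real (v i))) > 0"
    (is "degree ?p > 0")
proof -
  have "coeff ?p (card S - length us) = of_real (mixed_perm us S v)"
    using coeff_mixed_perm_line_top[of S "map ((\<circ>) complex_of_real) us" "\<lambda>i. of_real (v i)" z] assms
    by (auto simp: mixed_perm_of_real order.strict_iff_order)
  moreover have "mixed_perm us S v > 0" using assms by (intro mixed_perm_pos) auto
  ultimately show ?thesis using assms(2) le_degree[of ?p "card S - length us"] by simp
qed

text \<open>Adding a column \<open>v\<close> is a directional derivative. As \<open>v\<close> is
  positive, \<open>z + s * v\<close> stays in the open upper half space for Im s >= 0, so the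
  Gauss-Lucas argument on this line carries nonvanishing over to the derivative.\<close>

lemma mixed_perm_stable:
  fixes us :: "('i \<Rightarrow> real) list"
  assumes "finite S" "length us \<le> card S" "\<And>i. i \<in> S \<Longrightarrow> Im (z i) > 0"
    "\<And>u i. u \<in> set us \<Longrightarrow> i \<in> S \<Longrightarrow> u i > 0"
  shows "mixed_perm (map ((\<circ>) complex_of_real) us) S z \<noteq> 0"
  using assms
proof (induction us arbitrary: z rule: rev_induct)
  case Nil
  then show ?case by force
next
  case (snoc v us)
  let ?p = "mixed_perm_line (map ((\<circ>) complex_of_real) us) S z (\<lambda>i. of_real (v i))"
  have "poly ?p s \<noteq> 0" if "Im s \<ge> 0" for s
    unfolding poly_mixed_perm_line
    using snoc.prems that by (intro snoc.IH) (auto intro!: add_pos_nonneg mult_nonneg_nonneg simp: less_imp_le)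
  moreover have "degree ?p > 0"
    using snoc.prems by (intro degree_mixed_perm_line_pos) auto
  ultimately have "poly (pderiv ?p) 0 \<noteq> 0" by (rule poly_pderiv_0_nonzero)
  moreover have "map ((\<circ>) complex_of_real) (us @ [v]) =
      map ((\<circ>) complex_of_real) us @ [\<lambda>i. of_real (v i)]"
    by (simp add: fun_eq_iff)
  ultimately show ?case by (metis poly_pderiv_mixed_perm_line_0)
qed

text \<open>The polynomial on the line has only negative real roots: stability excludes the upper
  half plane, conjugation the lower one, and positivity of mixed permanents the nonnegative
  axis.\<close>

lemma mixed_perm_exp_bound:
  fixes us :: "('i \<Rightarrow> real) list"
  assumes S: "finite S" "length us < card S"
    and z: "\<And>i. i \<in> S \<Longrightarrow> z i > 0" and v: "\<And>i. i \<in> S \<Longrightarrow> v i > 0"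
    and us: "\<And>u i. u \<in> set us \<Longrightarrow> i \<in> S \<Longrightarrow> u i > 0" and t: "t \<ge> 0"
  shows "mixed_perm us S (\<lambda>i. z i + t * v i) \<le>
    mixed_perm us S z * exp (t * (mixed_perm (us @ [v]) S z / mixed_perm us S z))"
proof (rule poly_le_exp_pderiv_0)
  let ?p = "mixed_perm_line (map ((\<circ>) complex_of_real) us) S (\<lambda>i. of_real (z i)) (\<lambda>i. of_real (v i))"
  have real: "poly ?p (of_real x) = of_real (mixed_perm us S (\<lambda>i. z i + x * v i))" for x
    by (simp add: poly_mixed_perm_line flip: mixed_perm_of_real)
  show "poly ?p 0 = of_real (mixed_perm us S z)" using real[of 0] by simp
  show "mixed_perm us S z > 0" using assms by (intro mixed_perm_pos) auto
  show "poly (pderiv ?p) 0 = of_real (mixed_perm (us @ [v]) S z)"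
    by (simp add: poly_pderiv_mixed_perm_line_0 comp_def[of complex_of_real v] flip: mixed_perm_of_real)
  show "poly ?p (of_real t) = of_real (mixed_perm us S (\<lambda>i. z i + t * v i))" by (rule real)
  show "t \<ge> 0" by fact
  have upper: "poly ?p s \<noteq> 0" if "Im s > 0" for s
    unfolding poly_mixed_perm_line using assms that by (intro mixed_perm_stable) auto
  have "map ((\<circ>) cnj) (map ((\<circ>) complex_of_real) us) = map ((\<circ>) complex_of_real) us"
    by (auto simp: fun_eq_iff)
  \<comment> \<open>The coefficients are real, so the set of roots is symmetric about the real
    axis.\<close>
  then have cnj: "poly ?p (cnj s) = cnj (poly ?p s)" for s
    using mixed_perm_hom[of cnj "map ((\<circ>) complex_of_real) us" S "\<lambda>i. of_real (z i) + s * of_real (v i)"]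
    by (simp add: poly_mixed_perm_line comp_def[of cnj "\<lambda>i. of_real (z i) + s * of_real (v i)"] del: map_map)
  fix s assume s: "poly ?p s = 0"
  have "Im s = 0"
    using upper[of s] upper[of "cnj s"] s cnj[of s] by (cases "Im s" "0 :: real" rule: linorder_cases) auto
  then have s_real: "s = of_real (Re s)" by (simp add: complex_eq_iff)
  have "Re s < 0"
  proof (rule ccontr)
    assume "\<not> Re s < 0"
    then have "mixed_perm us S (\<lambda>i. z i + Re s * v i) > 0"
      using assms by (intro mixed_perm_pos) (auto intro!: add_pos_nonneg mult_nonneg_nonneg simp: less_imp_le)
    then show False using s real[of "Re s"] s_real by simp
  qed
  then show "s \<in> \<real> \<and> Re s < 0" using s_real by (metis Reals_of_real)
qed


section \<open>A lower bound for permanents of doubly stochastic matrices\<close>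

text \<open>Weighted AM-GM for each \<open>i\<close>, multiplied over all \<open>i\<close>; the
  column sums give every \<open>x j\<close> the total exponent 1.\<close>

lemma prod_le_prod_doubly_stochastic:
  fixes C :: "'j \<Rightarrow> 'i \<Rightarrow> real"
  assumes fin: "finite J" "finite S"
    and pos: "\<And>j i. j \<in> J \<Longrightarrow> i \<in> S \<Longrightarrow> C j i \<ge> 0" and x: "\<And>j. j \<in> J \<Longrightarrow> x j > 0"
    and row: "\<And>i. i \<in> S \<Longrightarrow> (\<Sum>j\<in>J. C j i) = 1" and col: "\<And>j. j \<in> J \<Longrightarrow> (\<Sum>i\<in>S. C j i) = 1"
  shows "(\<Prod>j\<in>J. x j) \<le> (\<Prod>i\<in>S. \<Sum>j\<in>J. x j * C j i)"
proof -
  have am_gm: "exp (\<Sum>j\<in>J. ln (x j) * C j i) \<le> (\<Sum>j\<in>J. x j * C j i)" if i: "i \<in> S" for i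
  proof -
    define M where "M = (\<Sum>j\<in>J. ln (x j) * C j i)"
    \<comment> \<open>Tangent of exp at the weighted mean \<open>M\<close> of the logarithms: the
      deviations from \<open>M\<close> average to zero, and each tangent value is at most
      \<open>x j\<close>.\<close>
    have "exp M = (\<Sum>j\<in>J. exp M * (1 + (ln (x j) - M)) * C j i)"
    proof -
      have "(\<Sum>j\<in>J. exp M * (1 + (ln (x j) - M)) * C j i) =
          (\<Sum>j\<in>J. exp M * (1 - M) * C j i + exp M * (ln (x j) * C j i))"
        by (intro sum.cong) (auto simp: algebra_simps)
      also have "\<dots> = exp M * (1 - M) * (\<Sum>j\<in>J. C j i) + exp M * M"
        by (simp add: sum.distrib M_def flip: sum_distrib_left)
      also have "\<dots> = exp M" using row[OF i] by (simp add: algebra_simps)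
      finally show ?thesis ..
    qed
    also have "\<dots> \<le> (\<Sum>j\<in>J. x j * C j i)"
    proof (intro sum_mono mult_right_mono)
      fix j assume j: "j \<in> J"
      have "exp M * (1 + (ln (x j) - M)) \<le> exp M * exp (ln (x j) - M)"
        by (intro mult_left_mono exp_ge_add_one_self) simp
      also have "\<dots> = x j" using x[OF j] by (simp flip: exp_add)
      finally show "exp M * (1 + (ln (x j) - M)) \<le> x j" .
      show "C j i \<ge> 0" using pos[OF j i] .
    qed
    finally show ?thesis by (simp add: M_def)
  qed
  have "(\<Sum>i\<in>S. \<Sum>j\<in>J. ln (x j) * C j i) = (\<Sum>j\<in>J. ln (x j) * (\<Sum>i\<in>S. C j i))"
    unfolding sum_distrib_left by (rule sum.swap)
  also have "\<dots> = (\<Sum>j\<in>J. ln (x j))" using col by simp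
  finally have "(\<Prod>i\<in>S. exp (\<Sum>j\<in>J. ln (x j) * C j i)) = (\<Prod>j\<in>J. exp (ln (x j)))"
    by (metis exp_sum fin)
  also have "\<dots> = (\<Prod>j\<in>J. x j)" using x by (intro prod.cong) auto
  finally show ?thesis using am_gm by (metis (no_types, lifting) exp_ge_zero prod_mono)
qed

text \<open>Gurvits' capacity argument: choosing \<open>t = p(0)/p'(0)\<close> in \<open>p(t) \<le> p(0) exp (t p'(0)/p(0))\<close>
  shows that replacing \<open>p\<close> by \<open>p'(0)\<close> loses at most a factor \<open>e\<close> in \<open>inf p(t)/t\<close>.\<close>
lemma mixed_perm_capacity:
  fixes C :: "nat \<Rightarrow> 'i \<Rightarrow> real"
  assumes S: "finite S" "card S = n"
    and pos: "\<And>j i. j < n \<Longrightarrow> i \<in> S \<Longrightarrow> C j i > 0"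
    and row: "\<And>i. i \<in> S \<Longrightarrow> (\<Sum>j<n. C j i) = 1" and col: "\<And>j. j < n \<Longrightarrow> (\<Sum>i\<in>S. C j i) = 1"
    and "d < n" and "\<And>j. j < n \<Longrightarrow> x j > 0"
  shows "exp (- real d) * (\<Prod>j=d..<n. x j) \<le>
    mixed_perm (map C [0..<d]) S (\<lambda>i. \<Sum>j=d..<n. x j * C j i)"
  using \<open>d < n\<close> \<open>\<And>j. j < n \<Longrightarrow> x j > 0\<close>
proof (induction d arbitrary: x)
  case 0
  have "(\<Prod>j<n. x j) \<le> (\<Prod>i\<in>S. \<Sum>j<n. x j * C j i)"
    using S 0 by (intro prod_le_prod_doubly_stochastic) (auto simp: row col less_imp_le[OF pos])
  then show ?case by (simp add: lessThan_atLeast0)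
next
  case (Suc d)
  define z where "z i = (\<Sum>j=Suc d..<n. x j * C j i)" for i
  define us where "us = map C [0..<d]"
  define P where "P = (\<Prod>j=Suc d..<n. x j)"
  define a where "a = mixed_perm us S z"
  define b where "b = mixed_perm (us @ [C d]) S z"
  have z: "z i > 0" if "i \<in> S" for i
    unfolding z_def using Suc.prems that by (intro sum_pos) (auto intro!: mult_pos_pos pos)
  have us: "u i > 0" if "u \<in> set us" "i \<in> S" for u i
    using that Suc.prems by (auto simp: us_def intro: pos)
  have a: "a > 0" and b: "b > 0"
    unfolding a_def b_def using S z us Suc.prems
    by (auto intro!: mixed_perm_pos pos simp: us_def)
  define t where "t = a / b"
  have t: "t > 0" using a b by (simp add: t_def)
  \<comment> \<open>The claim for \<open>Suc d\<close> does not involve \<open>x d\<close>, so the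
    induction hypothesis may be used with \<open>t\<close> in its place.\<close>
  have "exp (- real d) * (t * P) = exp (- real d) * (\<Prod>j=d..<n. (x(d := t)) j)"
    using Suc.prems(1) by (simp add: P_def prod.atLeast_Suc_lessThan)
  also have "\<dots> \<le> mixed_perm us S (\<lambda>i. \<Sum>j=d..<n. (x(d := t)) j * C j i)"
    unfolding us_def using Suc.prems t by (intro Suc.IH) auto
  also have "(\<lambda>i. \<Sum>j=d..<n. (x(d := t)) j * C j i) = (\<lambda>i. z i + t * C d i)"
    using Suc.prems(1) by (simp add: z_def sum.atLeast_Suc_lessThan add.commute)
  also have "mixed_perm us S (\<lambda>i. z i + t * C d i) \<le> a * exp (t * (b / a))"
    unfolding a_def b_def using S z us t Suc.prems
    by (intro mixed_perm_exp_bound) (auto simp: us_def intro: pos)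
  also have "t * (b / a) = 1" using a b by (simp add: t_def)
  also have "a = b * t" using b by (simp add: t_def)
  finally have "exp (- real d) * (t * P) \<le> b * t * exp 1" .
  then have "exp (- real d) * P \<le> b * exp 1" using t by simp
  then have "exp (- real (Suc d)) * P \<le> b"
    by (simp add: exp_diff exp_minus field_simps exp_add)
  then show ?case by (simp add: b_def P_def us_def flip: z_def)
qed

lemma permanent_positive_doubly_stochastic_ge:
  fixes C :: "nat \<Rightarrow> 'i \<Rightarrow> real"
  assumes S: "finite S" "card S = n"
    and pos: "\<And>j i. j < n \<Longrightarrow> i \<in> S \<Longrightarrow> C j i > 0"
    and row: "\<And>i. i \<in> S \<Longrightarrow> (\<Sum>j<n. C j i) = 1" and col: "\<And>j. j < n \<Longrightarrow> (\<Sum>i\<in>S. C j i) = 1"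
  shows "exp (- real n) \<le> mixed_perm (map C [0..<n]) S y"
proof (cases n)
  case 0
  then show ?thesis using S by simp
next
  case (Suc d)
  \<comment> \<open>With n - 1 columns placed and all \<open>x j\<close> equal to 1, the remaining
    linear form is the last column itself.\<close>
  have "exp (- real d) * (\<Prod>j=d..<n. 1) \<le>
      mixed_perm (map C [0..<d]) S (\<lambda>i. \<Sum>j=d..<n. 1 * C j i)"
    using S row col Suc by (intro mixed_perm_capacity) (auto intro: pos)
  also have "\<dots> = mixed_perm (map C [0..<n]) S y"
    using mixed_perm_snoc_last[of S "map C [0..<d]" "C d" y] S Suc by simp
  finally have "exp (- real d) \<le> mixed_perm (map C [0..<n]) S y" by simp
  moreover have "exp (- real n) \<le> exp (- real d)" using Suc by simp
  ultimately show ?thesis by linarith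
qed

lemma tendsto_mixed_perm:
  fixes g :: "'j \<Rightarrow> 'i \<Rightarrow> real"
  assumes "\<And>j i. j \<in> set js \<Longrightarrow> ((\<lambda>e. f e j i) \<longlongrightarrow> g j i) F"
  shows "((\<lambda>e. mixed_perm (map (f e) js) S z) \<longlongrightarrow> mixed_perm (map g js) S z) F"
  using assms by (induction js arbitrary: S) (auto intro!: tendsto_sum tendsto_mult)

text \<open>Mixing with the uniform matrix keeps all line sums and makes the entries positive; the
  bound survives the limit because the permanent is continuous in the entries.\<close>

lemma permanent_doubly_stochastic_ge:
  fixes C :: "nat \<Rightarrow> 'i \<Rightarrow> real"
  assumes S: "finite S" "card S = n"
    and nonneg: "\<And>j i. j < n \<Longrightarrow> i \<in> S \<Longrightarrow> C j i \<ge> 0"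
    and row: "\<And>i. i \<in> S \<Longrightarrow> (\<Sum>j<n. C j i) = 1" and col: "\<And>j. j < n \<Longrightarrow> (\<Sum>i\<in>S. C j i) = 1"
  shows "exp (- real n) \<le> mixed_perm (map C [0..<n]) S y"
proof (cases "n = 0")
  case True
  then show ?thesis using S by simp
next
  case False
  define f where "f e j i = (1 - e) * C j i + e / real n" for e j i
  have "((\<lambda>e. mixed_perm (map (f e) [0..<n]) S y) \<longlongrightarrow> mixed_perm (map C [0..<n]) S y) (at_right 0)"
  proof (rule tendsto_mixed_perm)
    fix j i
    have "((\<lambda>e. (1 - e) * C j i + e / real n) \<longlongrightarrow> (1 - 0) * C j i + 0 / real n) (at_right 0)"
      using False by (intro tendsto_intros) auto
    then show "((\<lambda>e. f e j i) \<longlongrightarrow> C j i) (at_right 0)" by (simp add: f_def)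
  qed
  moreover have "eventually (\<lambda>e. exp (- real n) \<le> mixed_perm (map (f e) [0..<n]) S y) (at_right 0)"
  proof (rule eventually_at_right_less[of 0, THEN eventually_mp[rotated]])
    show "eventually (\<lambda>e. 0 < e \<longrightarrow> exp (- real n) \<le> mixed_perm (map (f e) [0..<n]) S y) (at_right 0)"
      unfolding eventually_at_right_field
    proof (intro exI[of _ 1] conjI allI impI)
      fix e :: real assume e: "0 < e" "e < 1"
      show "exp (- real n) \<le> mixed_perm (map (f e) [0..<n]) S y"
      proof (rule permanent_positive_doubly_stochastic_ge[OF S])
        show "f e j i > 0" if "j < n" "i \<in> S" for j i
          unfolding f_def using e nonneg[OF that] False by (intro add_nonneg_pos) auto
        show "(\<Sum>j<n. f e j i) = 1" if "i \<in> S" for i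
          using row[OF that] False by (simp add: f_def sum.distrib flip: sum_distrib_left)
        show "(\<Sum>i\<in>S. f e j i) = 1" if "j < n" for j
          using col[OF that] S False by (simp add: f_def sum.distrib flip: sum_distrib_left)
      qed
    qed simp
  qed
  ultimately show ?thesis by (rule tendsto_lowerbound) simp
qed

section \<open>Transversals of regular zero-one matrices\<close>

lemma mixed_perm_scale:
  "mixed_perm (map (\<lambda>j i. a * f j i) js) S z = a ^ length js * mixed_perm (map f js) S z"
  by (induction js arbitrary: S) (auto simp: sum_distrib_left mult_ac)

text \<open>Expanding along the first column corresponds to choosing the head of the list;
  unoccupied rows contribute 1.\<close>

lemma mixed_perm_of_bool:
  assumes "finite S"
  shows "mixed_perm (map (\<lambda>j i. of_bool (R j i)) js) S (\<lambda>_. 1) =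
    real (card {xs. distinct xs \<and> set xs \<subseteq> S \<and> list_all2 R js xs})"
  using assms
proof (induction js arbitrary: S)
  case Nil
  have "{xs. distinct xs \<and> set xs \<subseteq> S \<and> list_all2 R [] xs} = {[]}" by auto
  then show ?case by simp
next
  case (Cons j js)
  define M where "M T = {xs. distinct xs \<and> set xs \<subseteq> T \<and> list_all2 R js xs}" for T
  have fin: "finite (M T)" if "finite T" for T
    using finite_lists_length_eq[OF that, of "length js"]
    by (rule finite_subset[rotated]) (auto simp: M_def dest: list_all2_lengthD)
  have "{xs. distinct xs \<and> set xs \<subseteq> S \<and> list_all2 R (j # js) xs} =
      (\<lambda>(i, xs). i # xs) ` (SIGMA i:{i\<in>S. R j i}. M (S - {i}))"
    by (auto simp: M_def list_all2_Cons1 image_iff)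
  also have "card \<dots> = (\<Sum>i\<in>{i\<in>S. R j i}. card (M (S - {i})))"
    using Cons.prems fin by (subst card_image) (auto simp: inj_on_def intro: card_SigmaI)
  also have "real \<dots> = (\<Sum>i\<in>S. of_bool (R j i) * real (card (M (S - {i}))))"
    unfolding of_nat_sum sum.inter_filter[OF Cons.prems] by (intro sum.cong) auto
  finally show ?case using Cons by (simp add: M_def)
qed

text \<open>Dividing the \<open>k\<close>-regular zero-one matrix by \<open>k\<close> makes it
  doubly stochastic, and scales its permanent by \<open>k\<close> to the power
  \<open>- n\<close>.\<close>

lemma regular_transversals_ge:
  assumes S: "finite S" "card S = n" and k: "k > 0"
    and col: "\<And>j. j < n \<Longrightarrow> card {i \<in> S. R j i} = k"
    and row: "\<And>i. i \<in> S \<Longrightarrow> card {j. j < n \<and> R j i} = k"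
  shows "(real k / exp 1) ^ n \<le> real (card {xs. distinct xs \<and> set xs \<subseteq> S \<and> list_all2 R [0..<n] xs})"
proof -
  define B :: "nat \<Rightarrow> 'a \<Rightarrow> real" where "B j i = of_bool (R j i)" for j i
  have "exp (- real n) \<le> mixed_perm (map (\<lambda>j i. 1 / real k * B j i) [0..<n]) S (\<lambda>_. 1)"
  proof (rule permanent_doubly_stochastic_ge[OF S])
    show "(\<Sum>j<n. 1 / real k * B j i) = 1" if "i \<in> S" for i
    proof -
      have "{j. j < n \<and> R j i} = {..<n} \<inter> {j. R j i}" by auto
      then have "(\<Sum>j<n. B j i) = real k" using row[OF that] by (simp add: B_def)
      then show ?thesis using k by (simp flip: sum_distrib_left sum_divide_distrib)
    qed
    show "(\<Sum>i\<in>S. 1 / real k * B j i) = 1" if "j < n" for j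
    proof -
      have "{i \<in> S. R j i} = S \<inter> {i. R j i}" by auto
      then have "(\<Sum>i\<in>S. B j i) = real k" using col[OF that] S by (simp add: B_def)
      then show ?thesis using k by (simp flip: sum_distrib_left sum_divide_distrib)
    qed
  qed (simp add: B_def)
  also have "\<dots> = (1 / real k) ^ n * mixed_perm (map B [0..<n]) S (\<lambda>_. 1)"
    by (simp only: mixed_perm_scale length_upt diff_zero)
  finally have "real k ^ n * exp (- real n) \<le> mixed_perm (map B [0..<n]) S (\<lambda>_. 1)"
    using k by (simp add: field_simps)
  moreover have "(real k / exp 1) ^ n = real k ^ n * exp (- real n)"
    by (simp add: power_divide exp_minus field_simps flip: exp_of_nat_mult)
  ultimately show ?thesis
    unfolding B_def by (simp only: mixed_perm_of_bool[OF S(1)])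
qed

section \<open>Counting latin squares\<close>

text \<open>Latin rectangles as lists of rows, so that adding a row is a Cons.\<close>

definition latin_rows :: "nat \<Rightarrow> nat list list \<Rightarrow> bool" where
  "latin_rows m xss \<longleftrightarrow>
     (\<forall>xs\<in>set xss. length xs = m \<and> distinct xs \<and> set xs \<subseteq> {..<m}) \<and>
     (\<forall>c<m. distinct (map (\<lambda>xs. xs ! c) xss))"

lemma finite_latin_rows: "finite {xss. latin_rows m xss \<and> length xss = r}"
proof (rule finite_subset)
  show "finite {xss. set xss \<subseteq> {xs. set xs \<subseteq> {..<m} \<and> length xs = m} \<and> length xss = r}"
    by (intro finite_lists_length_eq) simp
qed (auto simp: latin_rows_def)

text \<open>Pigeonhole: \<open>m\<close> distinct values below \<open>m\<close> exhaust all of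
  them.\<close>

lemma ex1_nth_eq:
  assumes "distinct xs" "length xs = m" "set xs \<subseteq> {..<m}" "s < m"
  shows "\<exists>!c. c < m \<and> xs ! c = s"
proof -
  have "set xs = {..<m}"
    using assms by (intro card_subset_eq) (auto simp: distinct_card)
  then have "s \<in> set xs" using assms by simp
  then show ?thesis using assms by (auto simp: in_set_conv_nth nth_eq_iff_index_eq)
qed

text \<open>The next row is a transversal of the relation "\<open>s\<close> is still missing in
  column \<open>c\<close>". It is regular of degree \<open>m - r\<close>: each column has used
  \<open>r\<close> symbols, and each symbol has occurred once in each of the \<open>r\<close> rows,
  in different columns.\<close>

lemma latin_rows_extensions_ge:
  assumes L: "latin_rows m xss" and r: "length xss = r" "r < m"
  shows "(real (m - r) / exp 1) ^ m \<le> real (card {xs. latin_rows m (xs # xss)})"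
proof -
  define R where "R c s \<longleftrightarrow> s \<notin> (\<lambda>xs. xs ! c) ` set xss" for c s
  have row: "length xs = m" "distinct xs" "set xs \<subseteq> {..<m}" if "xs \<in> set xss" for xs
    using L that by (auto simp: latin_rows_def)
  have dist: "distinct (map (\<lambda>xs. xs ! c) xss)" if "c < m" for c
    using L that by (auto simp: latin_rows_def)
  have "(real (m - r) / exp 1) ^ m \<le>
      real (card {xs. distinct xs \<and> set xs \<subseteq> {..<m} \<and> list_all2 R [0..<m] xs})"
  proof (rule regular_transversals_ge)
    fix c assume c: "c < m"
    have "{s\<in>{..<m}. R c s} = {..<m} - set (map (\<lambda>xs. xs ! c) xss)"
      by (auto simp: R_def)
    moreover have "set (map (\<lambda>xs. xs ! c) xss) \<subseteq> {..<m}"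
      using row c by (auto simp: subset_iff)
    moreover have "card (set (map (\<lambda>xs. xs ! c) xss)) = r"
      using distinct_card[OF dist[OF c]] r by simp
    ultimately show "card {s\<in>{..<m}. R c s} = m - r"
      by (simp add: card_Diff_subset)
  next
    fix s assume s: "s \<in> {..<m}"
    define D where "D xs = {c. c < m \<and> xs ! c = s}" for xs :: "nat list"
    have D: "card (D xs) = 1" if "xs \<in> set xss" for xs
      using ex1_nth_eq[of xs m s] row[OF that] s
      by (auto simp: D_def card_1_singleton_iff set_eq_iff)
    have "card (\<Union>xs\<in>set xss. D xs) = (\<Sum>xs\<in>set xss. card (D xs))"
    proof (rule card_UN_disjoint)
      show "\<forall>xs\<in>set xss. \<forall>ys\<in>set xss. xs \<noteq> ys \<longrightarrow> D xs \<inter> D ys = {}"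
        using dist by (auto simp: D_def distinct_map inj_on_def)
    qed (auto simp: D_def)
    also have "\<dots> = card (set xss)" using D by simp
    \<comment> \<open>The rows are distinct because their entries in column 0 are; this column
      exists since \<open>r < m\<close>.\<close>
    also have "\<dots> = r"
      using dist[of 0] r by (auto simp: distinct_map distinct_card)
    finally have "card (\<Union>xs\<in>set xss. D xs) = r" .
    moreover have "{c. c < m \<and> R c s} = {..<m} - (\<Union>xs\<in>set xss. D xs)"
      by (auto simp: R_def D_def)
    moreover have "(\<Union>xs\<in>set xss. D xs) \<subseteq> {..<m}" by (auto simp: D_def)
    ultimately show "card {c. c < m \<and> R c s} = m - r"
      by (simp add: card_Diff_subset finite_subset)
  qed (use r in auto)
  also have "{xs. distinct xs \<and> set xs \<subseteq> {..<m} \<and> list_all2 R [0..<m] xs} =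
      {xs. latin_rows m (xs # xss)}"
    using L by (auto simp: latin_rows_def R_def list_all2_conv_all_nth)
  finally show ?thesis .
qed

lemma latin_rows_ConsD: "latin_rows m (xs # xss) \<Longrightarrow> latin_rows m xss"
  by (simp add: latin_rows_def)

text \<open>Removing the newest row leaves a smaller rectangle, and the lower bound on the number of
  next rows is the same for every rectangle with \<open>r\<close> rows, so the bounds
  multiply.\<close>

lemma card_latin_rows_ge:
  assumes "r \<le> m"
  shows "(\<Prod>i<r. (real (m - i) / exp 1) ^ m) \<le> real (card {xss. latin_rows m xss \<and> length xss = r})"
  using assms
proof (induction r)
  case 0
  have "{xss. latin_rows m xss \<and> length xss = 0} = {[]}" by (auto simp: latin_rows_def)
  then show ?case by simp
next
  case (Suc r)
  define L where "L = {xss. latin_rows m xss \<and> length xss = r}"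
  define E where "E xss = {xs. latin_rows m (xs # xss)}" for xss
  have finE: "finite (E xss)" for xss
    by (rule finite_subset[of _ "{xs. set xs \<subseteq> {..<m} \<and> length xs = m}"])
      (auto simp: E_def latin_rows_def intro: finite_lists_length_eq)
  have "{xss. latin_rows m xss \<and> length xss = Suc r} = (\<lambda>(xss, xs). xs # xss) ` Sigma L E"
  proof (rule set_eqI)
    fix yss
    show "yss \<in> {xss. latin_rows m xss \<and> length xss = Suc r} \<longleftrightarrow>
        yss \<in> (\<lambda>(xss, xs). xs # xss) ` Sigma L E"
      by (cases yss) (auto simp: L_def E_def image_iff dest: latin_rows_ConsD)
  qed
  also have "card \<dots> = (\<Sum>xss\<in>L. card (E xss))"
    using finE finite_latin_rows[of m r]
    by (subst card_image) (auto simp: inj_on_def L_def intro: card_SigmaI)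
  finally have card: "real (card {xss. latin_rows m xss \<and> length xss = Suc r}) =
      (\<Sum>xss\<in>L. real (card (E xss)))" by simp
  have "(\<Prod>i<Suc r. (real (m - i) / exp 1) ^ m) \<le> real (card L) * (real (m - r) / exp 1) ^ m"
    using Suc by (auto simp: L_def intro!: mult_right_mono)
  also have "\<dots> = (\<Sum>xss\<in>L. (real (m - r) / exp 1) ^ m)" by simp
  also have "\<dots> \<le> (\<Sum>xss\<in>L. real (card (E xss)))"
    unfolding E_def using Suc.prems
    by (intro sum_mono latin_rows_extensions_ge) (auto simp: L_def)
  finally show ?case by (simp add: card)
qed

lemma latin_square_of_rows:
  assumes "latin_rows m xss" "length xss = m"
  shows "latin_square m {(i, c, xss ! i ! c) | i c. i < m \<and> c < m}"
proof -
  have row: "length (xss ! i) = m" "distinct (xss ! i)" "set (xss ! i) \<subseteq> {..<m}" if "i < m" for i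
    using assms that by (auto simp: latin_rows_def)
  have lt: "xss ! i ! c < m" if "i < m" "c < m" for i c
    using row[OF that(1)] that(2) by (auto simp: subset_iff)
  have "\<exists>!c. c < m \<and> s = xss ! i ! c" if "i < m" "s < m" for i s
    using ex1_nth_eq[OF row(2,1,3)[OF that(1)] that(2)] by (simp add: eq_commute[of s])
  moreover have "\<exists>!i. i < m \<and> s = xss ! i ! c" if c: "c < m" and s: "s < m" for c s
  proof -
    \<comment> \<open>The pigeonhole lemma applied to column \<open>c\<close> written as a
      list.\<close>
    have "\<exists>!i. i < m \<and> map (\<lambda>xs. xs ! c) xss ! i = s"
      using assms c s lt by (intro ex1_nth_eq) (auto simp: latin_rows_def in_set_conv_nth)
    moreover have "i < m \<and> map (\<lambda>xs. xs ! c) xss ! i = s \<longleftrightarrow> i < m \<and> xss ! i ! c = s" for i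
      using assms(2) by auto
    ultimately show ?thesis by (simp add: eq_commute[of s])
  qed
  moreover have "(i, c, s) \<in> {(i, c, xss ! i ! c) | i c. i < m \<and> c < m} \<longleftrightarrow>
      i < m \<and> c < m \<and> s = xss ! i ! c" for i c s
    by auto
  ultimately show ?thesis
    unfolding latin_square_def using lt by (simp add: subset_iff)
qed

lemma card_latin_squares_ge_rows:
  "card {xss. latin_rows m xss \<and> length xss = m} \<le> card {L. latin_square m L}"
proof (rule card_inj_on_le)
  let ?f = "\<lambda>xss. {(i, c, xss ! i ! c) | i c. i < m \<and> c < m}"
  show "inj_on ?f {xss. latin_rows m xss \<and> length xss = m}"
  proof (rule inj_onI)
    fix xss yss
    assume "xss \<in> {xss. latin_rows m xss \<and> length xss = m}"
      "yss \<in> {xss. latin_rows m xss \<and> length xss = m}" and eq: "?f xss = ?f yss"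
    then have xss: "latin_rows m xss" "length xss = m" and yss: "latin_rows m yss" "length yss = m"
      by auto
    show "xss = yss"
    proof (rule nth_equalityI)
      fix i assume i: "i < length xss"
      have "length (xss ! i) = m" "length (yss ! i) = m"
        using xss yss i by (auto simp: latin_rows_def)
      moreover have "xss ! i ! c = yss ! i ! c" if "c < m" for c
      proof -
        have "(i, c, xss ! i ! c) \<in> ?f yss" using i xss that by (subst eq[symmetric]) auto
        then show ?thesis by auto
      qed
      ultimately show "xss ! i = yss ! i" by (auto intro: nth_equalityI)
    qed (use xss yss in simp)
  qed
  show "?f ` {xss. latin_rows m xss \<and> length xss = m} \<subseteq> {L. latin_square m L}"
    using latin_square_of_rows by auto
  show "finite {L. latin_square m L}" by (rule finite_latin_squares)
qed

section \<open>The explicit lower bound for latin squares of order m\<close>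

lemma fact_ge_power_exp: "(real m / exp 1) ^ m \<le> fact m"
proof (induction m)
  case (Suc m)
  \<comment> \<open>For \<open>m = 0\<close> both \<open>1 / 0 = 0\<close> and
    \<open>0 ^ 0 = 1\<close> enter, and the estimate still holds.\<close>
  have "(1 + 1 / real m) ^ m \<le> exp 1"
  proof -
    have "(1 + 1 / real m) ^ m \<le> exp (1 / real m) ^ m"
      by (intro power_mono exp_ge_add_one_self) auto
    also have "\<dots> \<le> exp 1" by (cases "m = 0") (auto simp flip: exp_of_nat_mult)
    finally show ?thesis .
  qed
  moreover have "real (Suc m) ^ m = (1 + 1 / real m) ^ m * real m ^ m"
    by (cases "m = 0") (auto simp: field_simps simp flip: power_mult_distrib)
  ultimately have "real (Suc m) ^ m \<le> exp 1 * real m ^ m"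
    by (simp add: mult_right_mono)
  then have "real (Suc m) ^ m / exp 1 ^ Suc m \<le> exp 1 * real m ^ m / exp 1 ^ Suc m"
    by (rule divide_right_mono) simp
  also have "\<dots> = (real m / exp 1) ^ m" by (simp add: power_divide)
  finally have "real (Suc m) * (real (Suc m) ^ m / exp 1 ^ Suc m) \<le> real (Suc m) * (real m / exp 1) ^ m"
    by (rule mult_left_mono) simp
  then have "(real (Suc m) / exp 1) ^ Suc m \<le> real (Suc m) * (real m / exp 1) ^ m"
    by (simp add: power_divide)
  also have "\<dots> \<le> real (Suc m) * fact m" using Suc by (intro mult_left_mono) auto
  finally show ?case by simp
qed simp

text \<open>One factor e comes from the permanent bound, the other from estimating the factorial in
  the product over all rows.\<close>

lemma card_latin_squares_ge: "(real m / exp 1 ^ 2) ^ (m ^ 2) \<le> real (card {L. latin_square m L})"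
proof -
  have "(\<Prod>i<m. real (m - i)) = fact m"
    by (simp add: fact_prod_rev lessThan_atLeast0)
  then have prod: "(\<Prod>i<m. (real (m - i) / exp 1) ^ m) = (fact m / exp 1 ^ m) ^ m"
    by (simp add: prod_dividef flip: prod_power_distrib)
  have "(real m / exp 1 ^ 2) ^ m = (real m / exp 1) ^ m / exp 1 ^ m"
    by (simp add: power_divide power2_eq_square power_mult_distrib)
  also have "\<dots> \<le> fact m / exp 1 ^ m"
    using fact_ge_power_exp[of m] by (intro divide_right_mono) auto
  finally have "((real m / exp 1 ^ 2) ^ m) ^ m \<le> (fact m / exp 1 ^ m) ^ m"
    by (intro power_mono) auto
  also have "\<dots> \<le> real (card {xss. latin_rows m xss \<and> length xss = m})"
    using card_latin_rows_ge[of m m] by (simp only: prod order.refl)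
  also have "\<dots> \<le> real (card {L. latin_square m L})"
    using card_latin_squares_ge_rows by simp
  finally show ?thesis by (simp add: power2_eq_square power_mult)
qed

section \<open>Blow-ups of cyclic groups\<close>

text \<open>The Cayley table of the integers modulo \<open>q\<close> with the cell \<open>(i, j)\<close> replaced by the latin
  square \<open>M (i, j)\<close> of order \<open>m\<close> on the \<open>(i + j) mod q\<close>-th block of symbols.\<close>
definition cyclic_blowup :: "nat \<Rightarrow> nat \<Rightarrow> (nat \<times> nat \<Rightarrow> entry set) \<Rightarrow> entry set" where
  "cyclic_blowup q m M = {(r, c, s). r < q * m \<and> c < q * m \<and> s < q * m \<and>
     s div m = (r div m + c div m) mod q \<and>
     (r mod m, c mod m, s mod m) \<in> M (r div m, c div m)}"

lemma block_index_less: "j * m + c < q * m" if "j < q" "c < m" for j q m c :: nat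
proof -
  have "j * m + c < Suc j * m" using that by simp
  also have "\<dots> \<le> q * m" using that by (intro mult_le_mono1) simp
  finally show ?thesis .
qed

text \<open>An index below \<open>q * m\<close> is a pair of block and offset; the block is
  determined first, then the offset within it.\<close>

lemma ex1_div_mod:
  fixes q m :: nat
  assumes "\<exists>!j. j < q \<and> P j" and "\<And>j. j < q \<Longrightarrow> P j \<Longrightarrow> \<exists>!c. c < m \<and> Q j c"
  shows "\<exists>!x. x < q * m \<and> P (x div m) \<and> Q (x div m) (x mod m)"
proof -
  obtain j where j: "j < q" "P j" "\<And>j'. j' < q \<Longrightarrow> P j' \<Longrightarrow> j' = j" using assms(1) by blast
  obtain c where c: "c < m" "Q j c" "\<And>c'. c' < m \<Longrightarrow> Q j c' \<Longrightarrow> c' = c"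
    using assms(2)[OF j(1,2)] by blast
  show ?thesis
  proof (rule ex1I[of _ "j * m + c"])
    show "j * m + c < q * m \<and> P ((j * m + c) div m) \<and> Q ((j * m + c) div m) ((j * m + c) mod m)"
      using j(1,2) c(1,2) block_index_less[OF j(1) c(1)] by simp
    fix x assume x: "x < q * m \<and> P (x div m) \<and> Q (x div m) (x mod m)"
    then have "x div m < q" by (simp add: less_mult_imp_div_less)
    then have div: "x div m = j" using x by (intro j(3)) auto
    have "x mod m = c" using x c(1) unfolding div by (intro c(3)) auto
    with div show "x = j * m + c" by (metis div_mult_mod_eq)
  qed
qed

lemma ex1_add_mod:
  fixes i k q :: nat
  assumes "i < q" "k < q"
  shows "\<exists>!j. j < q \<and> k = (i + j) mod q"
proof (rule ex1I)
  \<comment> \<open>The witness is k - i modulo \<open>q\<close>; adding \<open>q - i\<close> avoids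
    truncated subtraction.\<close>
  show "(k + (q - i)) mod q < q \<and> k = (i + (k + (q - i)) mod q) mod q"
    using assms by (simp add: mod_add_right_eq)
  fix j assume j: "j < q \<and> k = (i + j) mod q"
  then have "(k + (q - i)) mod q = (i + j + (q - i)) mod q"
    by (simp add: mod_add_left_eq)
  also have "i + j + (q - i) = j + q" using assms by simp
  finally show "j = (k + (q - i)) mod q" using j by simp
qed

text \<open>Two coordinates fix the third in two stages: its block by the Cayley table, its offset
  by the latin square in that cell.\<close>

lemma latin_square_cyclic_blowup:
  assumes M: "\<And>i j. i < q \<Longrightarrow> j < q \<Longrightarrow> latin_square m (M (i, j))"
  shows "latin_square (q * m) (cyclic_blowup q m M)"
proof -
  have block: "x div m < q" "x mod m < m" if "x < q * m" for x
    using that by (auto simp: less_mult_imp_div_less intro!: mod_less_divisor gr0I)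
  have sub: "r < m \<and> c < m \<and> s < m" if "(r, c, s) \<in> M (i, j)" "i < q" "j < q" for r c s i j
    using M[of i j] that by (auto simp: latin_square_def)
  have sym: "\<exists>!s. s < m \<and> (r, c, s) \<in> M (i, j)" if "i < q" "j < q" "r < m" "c < m" for i j r c
    using M[OF that(1,2)] that sub unfolding latin_square_def by metis
  have col: "\<exists>!c. c < m \<and> (r, c, s) \<in> M (i, j)" if "i < q" "j < q" "r < m" "s < m" for i j r s
    using M[OF that(1,2)] that sub unfolding latin_square_def by metis
  have row: "\<exists>!r. r < m \<and> (r, c, s) \<in> M (i, j)" if "i < q" "j < q" "c < m" "s < m" for i j c s
    using M[OF that(1,2)] that sub unfolding latin_square_def by metis
  have "\<exists>!s. (r, c, s) \<in> cyclic_blowup q m M" if rc: "r < q * m" "c < q * m" for r c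
  proof -
    have "q > 0" using rc by (intro gr0I) auto
    then have "\<exists>!k. k < q \<and> k = (r div m + c div m) mod q" by auto
    then have "\<exists>!s. s < q * m \<and> s div m = (r div m + c div m) mod q \<and>
        (r mod m, c mod m, s mod m) \<in> M (r div m, c div m)"
      by (rule ex1_div_mod[where Q = "\<lambda>k s. (r mod m, c mod m, s) \<in> M (r div m, c div m)"])
        (rule sym[OF block(1)[OF rc(1)] block(1)[OF rc(2)] block(2)[OF rc(1)] block(2)[OF rc(2)]])
    then show ?thesis using rc by (simp add: cyclic_blowup_def)
  qed
  moreover have "\<exists>!c. (r, c, s) \<in> cyclic_blowup q m M" if rs: "r < q * m" "s < q * m" for r s
  proof -
    have "\<exists>!c. c < q * m \<and> s div m = (r div m + c div m) mod q \<and>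
        (r mod m, c mod m, s mod m) \<in> M (r div m, c div m)"
      using ex1_add_mod[OF block(1)[OF rs(1)] block(1)[OF rs(2)]]
      by (rule ex1_div_mod[where Q = "\<lambda>j c. (r mod m, c, s mod m) \<in> M (r div m, j)"])
        (rule col[OF block(1)[OF rs(1)] _ block(2)[OF rs(1)] block(2)[OF rs(2)]])
    then show ?thesis using rs by (simp add: cyclic_blowup_def)
  qed
  moreover have "\<exists>!r. (r, c, s) \<in> cyclic_blowup q m M" if cs: "c < q * m" "s < q * m" for c s
  proof -
    have "\<exists>!i. i < q \<and> s div m = (i + c div m) mod q"
      using ex1_add_mod[OF block(1)[OF cs(1)] block(1)[OF cs(2)]] by (simp add: add.commute)
    then have "\<exists>!r. r < q * m \<and> s div m = (r div m + c div m) mod q \<and>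
        (r mod m, c mod m, s mod m) \<in> M (r div m, c div m)"
      by (rule ex1_div_mod[where Q = "\<lambda>i r. (r, c mod m, s mod m) \<in> M (i, c div m)"])
        (rule row[OF _ block(1)[OF cs(1)] block(2)[OF cs(1)] block(2)[OF cs(2)]])
    then show ?thesis using cs by (simp add: cyclic_blowup_def)
  qed
  ultimately show ?thesis
    unfolding latin_square_def by (auto simp: cyclic_blowup_def)
qed

text \<open>The square in cell \<open>(i, j)\<close> can be read back from the entries in that block
  of rows and columns.\<close>

lemma inj_on_cyclic_blowup:
  "inj_on (cyclic_blowup q m) (({..<q} \<times> {..<q}) \<rightarrow>\<^sub>E {L. latin_square m L})"
proof (rule inj_onI)
  let ?F = "({..<q} \<times> {..<q}) \<rightarrow>\<^sub>E {L. latin_square m L}"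
  fix M M' assume M: "M \<in> ?F" and M': "M' \<in> ?F"
    and eq: "cyclic_blowup q m M = cyclic_blowup q m M'"
  have entry: "(r, c, s) \<in> N (i, j) \<longleftrightarrow> r < m \<and> c < m \<and> s < m \<and>
      (i * m + r, j * m + c, (i + j) mod q * m + s) \<in> cyclic_blowup q m N"
    if "N \<in> ?F" "i < q" "j < q" for N i j r c s
  proof -
    have "latin_square m (N (i, j))" using PiE_mem[OF that(1), of "(i, j)"] that by simp
    then have "(r, c, s) \<in> N (i, j) \<Longrightarrow> r < m \<and> c < m \<and> s < m" by (auto simp: latin_square_def)
    moreover have "(i + j) mod q < q" using that by simp
    ultimately show ?thesis
      using that block_index_less by (auto simp: cyclic_blowup_def)
  qed
  show "M = M'"
  proof (rule PiE_ext[OF M M'])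
    fix p assume "p \<in> {..<q} \<times> {..<q}"
    then obtain i j where p: "p = (i, j)" "i < q" "j < q" by auto
    show "M p = M' p"
      unfolding p(1) using entry[OF M p(2,3)] entry[OF M' p(2,3)] eq by auto
  qed
qed

text \<open>For a plex, each of the three coordinates takes every value \<open>k\<close> times, so
  all three block sums agree.\<close>

lemma sum_over_fibres:
  fixes f :: "'a \<Rightarrow> nat"
  assumes "finite P" "f ` P \<subseteq> {..<n}" "\<And>i. i < n \<Longrightarrow> card {x \<in> P. f x = i} = k"
  shows "(\<Sum>x\<in>P. g (f x)) = k * (\<Sum>i<n. g i)"
proof -
  have "(\<Sum>x\<in>P. g (f x)) = (\<Sum>i<n. \<Sum>x\<in>{x \<in> P. f x = i}. g (f x))"
    using assms by (intro sum.group[symmetric]) auto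
  also have "\<dots> = (\<Sum>i<n. k * g i)" using assms(3) by (intro sum.cong) auto
  finally show ?thesis by (simp add: sum_distrib_left)
qed

text \<open>The Delta-lemma: \<open>r div m + c div m - s div m\<close> vanishes modulo \<open>q\<close> on every entry, but
  its sum over a \<open>k\<close>-plex with \<open>k\<close> odd is congruent to \<open>q / 2\<close>.\<close>
lemma cyclic_blowup_no_odd_plex:
  assumes "even q" "q > 0" "odd m"
  shows "\<not> odd_plex (q * m) (cyclic_blowup q m M) P"
proof
  assume "odd_plex (q * m) (cyclic_blowup q m M) P"
  then obtain k where k: "odd k" and plex: "plex k (q * m) (cyclic_blowup q m M) P"
    by (auto simp: odd_plex_def)
  have P: "P \<subseteq> cyclic_blowup q m M" using plex by (simp add: plex_def)
  have "card P = k * (q * m)" using plex by (simp add: plex_def)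
  moreover have "k * (q * m) > 0" using k assms by (auto intro: odd_pos)
  ultimately have fin: "finite P" by (metis card_eq_0_iff less_irrefl)
  have sets: "{x \<in> P. fst x = i} = {(r, c, s) \<in> P. r = i}"
      "{x \<in> P. fst (snd x) = i} = {(r, c, s) \<in> P. c = i}"
      "{x \<in> P. snd (snd x) = i} = {(r, c, s) \<in> P. s = i}" for i
    by auto
  define T where "T = k * (\<Sum>i<q * m. i div m)"
  have r: "(\<Sum>x\<in>P. fst x div m) = T" and c: "(\<Sum>x\<in>P. fst (snd x) div m) = T"
    and s: "(\<Sum>x\<in>P. snd (snd x) div m) = T"
    unfolding T_def using fin P plex
    by (auto intro!: sum_over_fibres simp: plex_def sets cyclic_blowup_def)
  \<comment> \<open>Summing the congruence between row, column and symbol blocks over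
    \<open>P\<close> gives 2T = T modulo \<open>q\<close>.\<close>
  have "(T + T) mod q = (\<Sum>x\<in>P. fst x div m + fst (snd x) div m) mod q"
    by (simp add: sum.distrib r c)
  also have "\<dots> = (\<Sum>x\<in>P. (fst x div m + fst (snd x) div m) mod q) mod q"
    by (simp add: mod_sum_eq)
  also have "(\<Sum>x\<in>P. (fst x div m + fst (snd x) div m) mod q) = (\<Sum>x\<in>P. snd (snd x) div m)"
    using P by (intro sum.cong) (auto simp: cyclic_blowup_def)
  finally have "q dvd T" by (simp add: s mod_eq_dvd_iff_nat)
  obtain h where h: "q = 2 * h" "h > 0" using assms by (auto elim: evenE)
  \<comment> \<open>Grouping by blocks: each value \<open>j\<close> of \<open>i div m\<close> is
    taken \<open>m\<close> times.\<close>
  have "(\<Sum>i<q * m. i div m) = (\<Sum>j<q. sum (\<lambda>i. i div m) {j * m..<j * m + m})"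
    by (rule sum.nat_group[symmetric])
  also have "\<dots> = (\<Sum>j<q. m * j)"
  proof (rule sum.cong)
    fix j
    have "i div m = j" if "i \<in> {j * m..<j * m + m}" for i
      using that by (intro div_nat_eqI) (auto simp: algebra_simps)
    then show "sum (\<lambda>i. i div m) {j * m..<j * m + m} = m * j" by simp
  qed simp
  also have "\<dots> = m * (\<Sum>j<2 * h. j)" by (simp add: h sum_distrib_left)
  also have "(\<Sum>j<2 * h. j) = h * (2 * h - 1)"
    by (induction h) (auto simp: algebra_simps)
  \<comment> \<open>With \<open>q = 2 * h\<close>, divisibility of \<open>T\<close> by
    \<open>q\<close> would make a product of three odd numbers even.\<close>
  finally have "T = h * (k * m * (2 * h - 1))" by (simp add: T_def mult_ac)
  with \<open>q dvd T\<close> h have "even (k * m * (2 * h - 1))" by (simp add: mult.commute[of 2 h])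
  moreover have "odd (2 * h - 1)" using h(2) by simp
  ultimately show False using k assms(3) by simp
qed

theorem theorem2p1:
  fixes n a m :: nat
  assumes "a > 0" and "m > 0" and "odd m" and "n = 2 ^ a * m"
  shows "real (card {L. latin_square n L \<and> (\<nexists>P. odd_plex n L P)})
           \<ge> (real m / exp 1 ^ 2) ^ (n ^ 2)"
proof -
  define q :: nat where "q = 2 ^ a"
  have q: "even q" "q > 0" "n = q * m" using assms by (auto simp: q_def)
  let ?F = "({..<q} \<times> {..<q}) \<rightarrow>\<^sub>E {L. latin_square m L}"
  \<comment> \<open>There are \<open>q * q\<close> cells, each filled independently, and n^2 = m^2
    q^2 matches the exponents.\<close>
  have "(real m / exp 1 ^ 2) ^ (n ^ 2) = ((real m / exp 1 ^ 2) ^ (m ^ 2)) ^ (q * q)"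
    by (simp add: q(3) power2_eq_square mult_ac flip: power_mult)
  also have "\<dots> \<le> real (card {L. latin_square m L}) ^ (q * q)"
    by (intro power_mono card_latin_squares_ge) simp
  also have "\<dots> = real (card ?F)" by (simp add: card_PiE)
  also have "card ?F \<le> card {L. latin_square n L \<and> (\<nexists>P. odd_plex n L P)}"
  proof (rule card_inj_on_le[OF inj_on_cyclic_blowup])
    show "cyclic_blowup q m ` ?F \<subseteq> {L. latin_square n L \<and> (\<nexists>P. odd_plex n L P)}"
      using latin_square_cyclic_blowup cyclic_blowup_no_odd_plex[OF q(1,2) assms(3)]
      unfolding q(3) by (fastforce simp: PiE_def Pi_def)
    show "finite {L. latin_square n L \<and> (\<nexists>P. odd_plex n L P)}"
      by (rule finite_subset[OF _ finite_latin_squares[of n]]) auto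
  qed
  finally show ?thesis by simp
qed

end
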